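(* Let $m_1\ge m_2>0$, $\theta:=m_2$, $m=m_1+m_2$, and consider a sufficiently smooth pair in Hessenberg form of order $2$, $$H_E=\begin{bmatrix}I_{m_1}&0\\ 0&0\end{bmatrix},\qquad H_F=\begin{bmatrix}H_{11}&H_{12}\\ H_{21}&0\end{bmatrix},\qquad H_{ij}:\mathcal I\to\mathbb{R}^{m_i\times m_j},$$ with $H_{21}(t)H_{12}(t)$ nonsingular for all $t\in\mathcal I$. Let $B_{d,2}:\mathcal I\to\mathbb{R}^{m_1\times(m_1-\theta)}$ and $B_{a,2}:\mathcal I\to\mathbb{R}^{m_1\times\theta}$ be sufficiently smooth matrix functions whose columns are pointwise orthonormal bases of $\ker H_{21}$ and of $(\ker H_{21})^{\perp}$, respectively, and set $$L_{orth}=\begin{bmatrix}B_{d,2}^T&0\\ B_{a,2}^T&0\\ 0&I_\theta\end{bmatrix},\qquad K_{orth}=\begin{bmatrix}B_{d,2}&0&B_{a,2}\\ 0&I_\theta&0\end{bmatrix}.$$ Then $L_{orth},K_{orth}$ are orthogonal and, with $d=m_1-m_2$ and $a=2\theta$, $$L_{orth}H_EK_{orth}=\begin{bmatrix}I_d&0\\ 0&N^{(E)}\end{bmatrix},\qquad N^{(E)}=\begin{bmatrix}0&I_\theta\\ 0&0\end{bmatrix},$$ and the pair $\{E_0,F_0\}$ with $E_0=L_{orth}H_EK_{orth}$, $F_0=L_{orth}H_FK_{orth}+L_{orth}H_EK_{orth}'=\begin{bmatrix}F_{11}&F_{12}\\ F_{21}&F_{22}\end{bmatrix}$ is in PreSCF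 (with two blocks of size $\theta$), where $F_{22}$ is block upper triangular with pointwise nonsingular diagonal blocks $B_{a,2}^TH_{12}$ and $H_{21}B_{a,2}$.
   Context: $\mathcal I\subseteq\mathbb{R}$ is an interval; all matrix functions are real and defined on $\mathcal I$; $'$ is differentiation in $t$. The matrix $F_0$ is partitioned so that $F_{11}$ is $d\times d$ and $F_{22}$ is $a\times a$; $a\times a$ matrix functions are partitioned into $2\times 2$ blocks of size $\theta\times\theta$. PreSCF: the pair $\left\{\begin{bmatrix} I_d&0\\ 0&N^{(E)}\end{bmatrix},\begin{bmatrix}F_{11}&F_{12}\\ F_{21}&F_{22}\end{bmatrix}\right\}$ is in PreSCF if $F_{22}$ and $F_{21}F_{12}$ are block upper triangular with the same block sizes as $N^{(E)}$ and $F_{22}$ is pointwise nonsingular. *)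

theory Defs
  imports "HOL-Analysis.Derivative" "Jordan_Normal_Form.Matrix_Kernel"
begin

text \<open>
  Matrices are those of \<open>Jordan_Normal_Form\<close>, whose dimensions are natural numbers; in particular
  blocks with 0 rows or columns are allowed.
  A matrix function on an interval \<open>I\<close> is a function \<open>real \<Rightarrow> real mat\<close> of which only the values on
  \<open>I\<close> matter.  Derivatives are taken entrywise and relative to \<open>I\<close>, hence one-sided at end points
  belonging to \<open>I\<close>.
\<close>

definition C1_mat_on :: "real set \<Rightarrow> nat \<Rightarrow> nat \<Rightarrow> (real \<Rightarrow> real mat) \<Rightarrow> bool" where
  "C1_mat_on I nr nc A \<longleftrightarrow>
     (\<forall>t\<in>I. A t \<in> carrier_mat nr nc) \<and>
     (\<forall>i<nr. \<forall>j<nc. \<exists>D :: real \<Rightarrow> real.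
        (\<forall>t\<in>I. ((\<lambda>s. A s $$ (i, j)) has_real_derivative D t) (at t within I)) \<and>
        continuous_on I D)"

definition mat_deriv :: "real set \<Rightarrow> (real \<Rightarrow> real mat) \<Rightarrow> real \<Rightarrow> real mat" where
  "mat_deriv I A t = mat (dim_row (A t)) (dim_col (A t))
     (\<lambda>(i, j). vector_derivative (\<lambda>s. A s $$ (i, j)) (at t within I))"

definition append_cols :: "'a :: zero mat \<Rightarrow> 'a mat \<Rightarrow> 'a mat" (infixr \<open>@\<^sub>c\<close> 70) where
  "A @\<^sub>c B = four_block_mat A B (0\<^sub>m 0 (dim_col A)) (0\<^sub>m 0 (dim_col B))"

text \<open>The library predicate \<open>orthogonal_mat\<close> does not normalise the columns.\<close>

definition orthogonal_matrix_of_size :: "nat \<Rightarrow> real mat \<Rightarrow> bool" where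
  "orthogonal_matrix_of_size n Q \<longleftrightarrow>
     Q \<in> carrier_mat n n \<and> Q\<^sup>T * Q = 1\<^sub>m n \<and> Q * Q\<^sup>T = 1\<^sub>m n"

definition columns_orthonormal_basis :: "nat \<Rightarrow> nat \<Rightarrow> real mat \<Rightarrow> real vec set \<Rightarrow> bool" where
  "columns_orthonormal_basis n k B W \<longleftrightarrow>
     B \<in> carrier_mat n k \<and>
     (\<forall>i<k. \<forall>j<k. scalar_prod (col B i) (col B j) = (if i = j then 1 else 0)) \<and>
     LinearCombinations.module.span class_ring (module_vec TYPE(real) n) (set (cols B)) = W"

text \<open>The list \<open>ns\<close> contains the sizes of the (square) diagonal blocks.\<close>

definition block_upper_triangular :: "nat list \<Rightarrow> real mat \<Rightarrow> bool" where
  "block_upper_triangular ns A \<longleftrightarrow>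
     A \<in> carrier_mat (sum_list ns) (sum_list ns) \<and>
     (\<forall>k<length ns. \<forall>l<k. \<forall>i<ns ! k. \<forall>j<ns ! l.
        A $$ (sum_list (take k ns) + i, sum_list (take l ns) + j) = 0)"

definition preSCF ::
  "real set \<Rightarrow> nat \<Rightarrow> nat list \<Rightarrow> (real \<Rightarrow> real mat) \<Rightarrow> (real \<Rightarrow> real mat) \<Rightarrow> (real \<Rightarrow> real mat) \<Rightarrow> bool"
where
  "preSCF I d ns N E F \<longleftrightarrow> (let a = sum_list ns in
     \<forall>t\<in>I. N t \<in> carrier_mat a a \<and>
           E t = four_block_mat (1\<^sub>m d) (0\<^sub>m d a) (0\<^sub>m a d) (N t) \<and>
           F t \<in> carrier_mat (d + a) (d + a) \<and>
           (case split_block (F t) d d of (F11, F12, F21, F22) \<Rightarrow>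
              block_upper_triangular ns F22 \<and>
              block_upper_triangular ns (F21 * F12) \<and>
              invertible_mat F22))"

definition hessenberg_E :: "nat \<Rightarrow> nat \<Rightarrow> real \<Rightarrow> real mat" where
  "hessenberg_E m1 m2 t = four_block_mat (1\<^sub>m m1) (0\<^sub>m m1 m2) (0\<^sub>m m2 m1) (0\<^sub>m m2 m2)"

definition hessenberg_F ::
  "nat \<Rightarrow> (real \<Rightarrow> real mat) \<Rightarrow> (real \<Rightarrow> real mat) \<Rightarrow> (real \<Rightarrow> real mat) \<Rightarrow> real \<Rightarrow> real mat" where
  "hessenberg_F m2 H11 H12 H21 t = four_block_mat (H11 t) (H12 t) (H21 t) (0\<^sub>m m2 m2)"

definition L_orth ::
  "nat \<Rightarrow> nat \<Rightarrow> (real \<Rightarrow> real mat) \<Rightarrow> (real \<Rightarrow> real mat) \<Rightarrow> real \<Rightarrow> real mat" where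
  "L_orth m1 \<theta> Bd Ba t =
     ((Bd t)\<^sup>T    @\<^sub>c 0\<^sub>m (m1 - \<theta>) \<theta>) @\<^sub>r
     ((Ba t)\<^sup>T    @\<^sub>c 0\<^sub>m \<theta> \<theta>) @\<^sub>r
     (0\<^sub>m \<theta> m1   @\<^sub>c 1\<^sub>m \<theta>)"

definition K_orth ::
  "nat \<Rightarrow> nat \<Rightarrow> (real \<Rightarrow> real mat) \<Rightarrow> (real \<Rightarrow> real mat) \<Rightarrow> real \<Rightarrow> real mat" where
  "K_orth m1 \<theta> Bd Ba t =
     (Bd t            @\<^sub>c 0\<^sub>m m1 \<theta> @\<^sub>c Ba t) @\<^sub>r
     (0\<^sub>m \<theta> (m1 - \<theta>) @\<^sub>c 1\<^sub>m \<theta>    @\<^sub>c 0\<^sub>m \<theta> \<theta>)"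

end

theory Submission
  imports Defs
begin

text \<open>
  Since \<open>[Bd Ba]\<close> is a square matrix with orthonormal columns, \<open>Bd Bd\<^sup>T + Ba Ba\<^sup>T = I\<close>, and \<open>H21 Bd = 0\<close>
  turns this into the factorisation \<open>H21 H12 = (H21 Ba) (Ba\<^sup>T H12)\<close> into square matrices, both of
  which are therefore nonsingular.  The middle block column of \<open>K\<close> is constant and the last block row
  of \<open>L H_E\<close> vanishes, so the derivative of \<open>K\<close> changes neither the diagonal nor the lower left blocks
  of \<open>F22\<close>, and the last block row of \<open>F21\<close> is zero.
\<close>

section \<open>Calculus of block matrices built by concatenating rows and columns\<close>

lemma dim_append_cols [simp]:
  "dim_row (A @\<^sub>c B) = dim_row A"
  "dim_col (A @\<^sub>c B) = dim_col A + dim_col B"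
  by (auto simp: append_cols_def)

lemma dim_append_rows [simp]:
  "dim_row (A @\<^sub>r B) = dim_row A + dim_row B"
  "dim_col (A @\<^sub>r B) = dim_col A"
  by (auto simp: append_rows_def)

lemma index_append_cols [simp]:
  "i < dim_row A \<Longrightarrow> j < dim_col A + dim_col B \<Longrightarrow>
    (A @\<^sub>c B) $$ (i, j) = (if j < dim_col A then A $$ (i, j) else B $$ (i, j - dim_col A))"
  by (auto simp: append_cols_def)

lemma index_append_rows [simp]:
  "i < dim_row A + dim_row B \<Longrightarrow> j < dim_col A \<Longrightarrow>
    (A @\<^sub>r B) $$ (i, j) = (if i < dim_row A then A $$ (i, j) else B $$ (i - dim_row A, j))"
  by (auto simp: append_rows_def)

lemma four_block_mat_as_append:
  assumes "dim_row A = dim_row B" "dim_row C = dim_row D"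
    "dim_col A = dim_col C" "dim_col B = dim_col D"
  shows "four_block_mat A B C D = (A @\<^sub>c B) @\<^sub>r (C @\<^sub>c D)"
  by (rule eq_matI) (use assms in auto)

lemma transpose_append_cols:
  "dim_row A = dim_row B \<Longrightarrow> (A @\<^sub>c B)\<^sup>T = A\<^sup>T @\<^sub>r B\<^sup>T"
  by (rule eq_matI) auto

lemma transpose_append_rows:
  "dim_col A = dim_col B \<Longrightarrow> (A @\<^sub>r B)\<^sup>T = A\<^sup>T @\<^sub>c B\<^sup>T"
  by (rule eq_matI) auto

lemma append_rows_mult:
  assumes "dim_col A = dim_row C" "dim_col B = dim_row C"
  shows "(A @\<^sub>r B) * C = A * C @\<^sub>r B * C"
proof (rule eq_matI)
  fix i j
  assume "i < dim_row (A * C @\<^sub>r B * C)" "j < dim_col (A * C @\<^sub>r B * C)"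
  then show "((A @\<^sub>r B) * C) $$ (i, j) = (A * C @\<^sub>r B * C) $$ (i, j)"
    using assms by (auto simp: scalar_prod_def)
qed (use assms in auto)

lemma mult_append_cols:
  assumes "dim_col C = dim_row A" "dim_row A = dim_row B"
  shows "C * (A @\<^sub>c B) = (C * A) @\<^sub>c (C * B)"
proof (rule eq_matI)
  fix i j
  assume "i < dim_row ((C * A) @\<^sub>c (C * B))" "j < dim_col ((C * A) @\<^sub>c (C * B))"
  then show "(C * (A @\<^sub>c B)) $$ (i, j) = ((C * A) @\<^sub>c (C * B)) $$ (i, j)"
    using assms by (auto simp: scalar_prod_def)
qed (use assms in auto)

lemma append_cols_mult_append_rows:
  fixes A :: "'a :: semiring_0 mat"
  assumes "dim_row A = dim_row B" "dim_col A = dim_row C" "dim_col B = dim_row D" "dim_col C = dim_col D"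
  shows "(A @\<^sub>c B) * (C @\<^sub>r D) = A * C + B * D"
proof (rule eq_matI)
  fix i j
  assume "i < dim_row (A * C + B * D)" "j < dim_col (A * C + B * D)"
  then have ij: "i < dim_row A" "j < dim_col C"
    using assms by auto
  have "((A @\<^sub>c B) * (C @\<^sub>r D)) $$ (i, j) =
      (\<Sum>k\<in>{0..<dim_col A + dim_col B}.
        (if k < dim_col A then A $$ (i, k) * C $$ (k, j)
         else B $$ (i, k - dim_col A) * D $$ (k - dim_col A, j)))"
    using ij assms by (auto simp: scalar_prod_def intro!: sum.cong)
  also have "\<dots> = (\<Sum>k\<in>{0..<dim_col A}. A $$ (i, k) * C $$ (k, j)) +
      (\<Sum>k\<in>{0..<dim_col B}. B $$ (i, k) * D $$ (k, j))"
    \<comment> \<open>The index range is cut at \<open>dim_col A\<close>, and its second half is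
      shifted down to start at 0.\<close>
    by (subst sum.atLeastLessThan_concat[symmetric, where n = "dim_col A"])
      (auto simp: sum.shift_bounds_nat_ivl[of _ 0 "dim_col A", simplified add_0] add.commute[of "dim_col A"])
  also have "\<dots> = (A * C + B * D) $$ (i, j)"
    using ij assms by (auto simp: scalar_prod_def)
  finally show "((A @\<^sub>c B) * (C @\<^sub>r D)) $$ (i, j) = (A * C + B * D) $$ (i, j)" .
qed (use assms in auto)

lemma append_rows_add_append_rows:
  "dim_row A = dim_row C \<Longrightarrow> dim_row B = dim_row D \<Longrightarrow> dim_col A = dim_col C \<Longrightarrow>
    dim_col B = dim_col D \<Longrightarrow> dim_col A = dim_col B \<Longrightarrow>
    (A @\<^sub>r B) + (C @\<^sub>r D) = (A + C) @\<^sub>r (B + D)"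
  by (rule eq_matI) auto

lemma append_cols_add_append_cols:
  "dim_row A = dim_row C \<Longrightarrow> dim_row B = dim_row D \<Longrightarrow> dim_col A = dim_col C \<Longrightarrow>
    dim_col B = dim_col D \<Longrightarrow> dim_row A = dim_row B \<Longrightarrow>
    (A @\<^sub>c B) + (C @\<^sub>c D) = (A + C) @\<^sub>c (B + D)"
  by (rule eq_matI) auto

lemma append_cols_interchange:
  "dim_row A = dim_row B \<Longrightarrow> dim_row C = dim_row D \<Longrightarrow> dim_col A = dim_col C \<Longrightarrow>
    dim_col B = dim_col D \<Longrightarrow> (A @\<^sub>c B) @\<^sub>r (C @\<^sub>c D) = (A @\<^sub>r C) @\<^sub>c (B @\<^sub>r D)"
  by (rule eq_matI) auto

lemma add_zero_mat_dim:
  fixes A :: "'a :: monoid_add mat"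
  assumes "dim_row A = nr" "dim_col A = nc"
  shows "A + 0\<^sub>m nr nc = A" "0\<^sub>m nr nc + A = A"
  by (rule eq_matI; use assms in auto)+

text \<open>Used as rewrite rules, these bring products, sums and transposes of block matrices to
  one normal form: block rows on the outside, block columns inside. For this reason the interchange
  law is reversed.\<close>

lemmas append_mult =
  append_rows_mult mult_append_cols append_cols_mult_append_rows
  append_rows_add_append_rows append_cols_add_append_cols
  add_zero_mat_dim transpose_append_cols transpose_append_rows append_cols_interchange[symmetric]

lemma split_block_append:
  assumes "dim_row A = dim_row B" "dim_row C = dim_row D"
    "dim_col A = dim_col C" "dim_col B = dim_col D"
  shows "split_block ((A @\<^sub>c B) @\<^sub>r (C @\<^sub>c D)) (dim_row A) (dim_col A) = (A, B, C, D)"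
  unfolding split_block_def Let_def prod.inject
  by (intro conjI; rule eq_matI) (use assms in auto)

lemma one_mat_as_append_3:
  "(1\<^sub>m k @\<^sub>c 0\<^sub>m k l @\<^sub>c 0\<^sub>m k n) @\<^sub>r (0\<^sub>m l k @\<^sub>c 1\<^sub>m l @\<^sub>c 0\<^sub>m l n) @\<^sub>r (0\<^sub>m n k @\<^sub>c 0\<^sub>m n l @\<^sub>c 1\<^sub>m n)
    = 1\<^sub>m (k + l + n)"
  by (rule eq_matI) auto

lemma one_mat_as_append:
  "(1\<^sub>m k @\<^sub>c 0\<^sub>m k l) @\<^sub>r (0\<^sub>m l k @\<^sub>c 1\<^sub>m l) = 1\<^sub>m (k + l)"
  by (rule eq_matI) auto

section \<open>Invertibility and triangularity of block matrices\<close>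

lemma invertible_mat_iff_det:
  fixes A :: "'a :: field mat"
  assumes A: "A \<in> carrier_mat n n"
  shows "invertible_mat A \<longleftrightarrow> det A \<noteq> 0"
proof
  assume "invertible_mat A"
  then obtain B where AB: "A * B = 1\<^sub>m n" and BA: "B * A = 1\<^sub>m (dim_row B)"
    using A by (auto simp: invertible_mat_def inverts_mat_def)
  \<comment> \<open>\<open>invertible_mat\<close> does not fix the size of the inverse; it is
    recovered by counting the columns in both identities.\<close>
  have "dim_col B = n" "dim_row B = n"
    using arg_cong[OF AB, of dim_col] arg_cong[OF BA, of dim_col] A by auto
  then have "det A * det B = 1"
    using det_mult[OF A, of B] AB by auto
  then show "det A \<noteq> 0" by auto
next
  assume "det A \<noteq> 0"
  \<comment> \<open>The parameter \<open>b\<close> only fills the extension slot of the ring record,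
    so any value serves.\<close>
  from det_non_zero_imp_unit[OF A this, where b = undefined] show "invertible_mat A"
    using A by (auto simp: Units_def ring_mat_def invertible_mat_def inverts_mat_def square_mat.simps)
qed

text \<open>Both factors are square, so the determinant is multiplicative and neither factor can
  have determinant 0.\<close>

lemma invertible_mat_factors:
  fixes A B :: "'a :: field mat"
  assumes "A \<in> carrier_mat n n" "B \<in> carrier_mat n n" "invertible_mat (A * B)"
  shows "invertible_mat A" "invertible_mat B"
  using assms by (auto simp: invertible_mat_iff_det[of _ n] det_mult)

text \<open>The determinant of a block triangular matrix is the product of those of its diagonal
  blocks.\<close>

lemma invertible_mat_upper_block:
  fixes A B D :: "'a :: field mat"
  assumes "A \<in> carrier_mat n n" "B \<in> carrier_mat n k" "D \<in> carrier_mat k k"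
    "invertible_mat A" "invertible_mat D"
  shows "invertible_mat ((A @\<^sub>c B) @\<^sub>r (0\<^sub>m k n @\<^sub>c D))"
proof -
  have eq: "(A @\<^sub>c B) @\<^sub>r (0\<^sub>m k n @\<^sub>c D) = four_block_mat A B (0\<^sub>m k n) D"
    using assms by (subst four_block_mat_as_append) auto
  have "det (four_block_mat A B (0\<^sub>m k n) D) = det A * det D"
    using assms by (intro det_four_block_mat_lower_left_zero[where n = n and m = k]) auto
  moreover have "four_block_mat A B (0\<^sub>m k n) D \<in> carrier_mat (n + k) (n + k)"
    using assms by auto
  ultimately show ?thesis
    using assms unfolding eq by (auto simp: invertible_mat_iff_det[of _ n] invertible_mat_iff_det[of _ k]
        invertible_mat_iff_det[of _ "n + k"])
qed

lemma block_upper_triangular_append: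
  assumes "A \<in> carrier_mat k k" "B \<in> carrier_mat k k" "D \<in> carrier_mat k k"
  shows "block_upper_triangular [k, k] ((A @\<^sub>c B) @\<^sub>r (0\<^sub>m k k @\<^sub>c D))"
  unfolding block_upper_triangular_def
proof (intro conjI allI impI)
  show "(A @\<^sub>c B) @\<^sub>r (0\<^sub>m k k @\<^sub>c D) \<in> carrier_mat (sum_list [k, k]) (sum_list [k, k])"
    using assms by (intro carrier_matI) auto
next
  fix p q i j
  assume pq: "p < length [k, k]" "q < p" and ij: "i < [k, k] ! p" "j < [k, k] ! q"
  then have "p = 1" "q = 0"
    by auto
  then show "((A @\<^sub>c B) @\<^sub>r (0\<^sub>m k k @\<^sub>c D)) $$
      (sum_list (take p [k, k]) + i, sum_list (take q [k, k]) + j) = 0"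
    using assms ij by simp
qed

section \<open>Matrix identities for orthonormal bases of a kernel and of its complement\<close>

lemma columns_orthonormal_basis_transpose_mult:
  assumes "columns_orthonormal_basis n k B W"
  shows "B\<^sup>T * B = 1\<^sub>m k"
  by (rule eq_matI) (use assms in \<open>auto simp: columns_orthonormal_basis_def\<close>)

lemma columns_orthonormal_basis_col_in:
  assumes "columns_orthonormal_basis n k B W" "j < k"
  shows "col B j \<in> W"
proof -
  interpret vec_module "TYPE(real)" n .
  have B: "B \<in> carrier_mat n k" and W: "span (set (cols B)) = W"
    using assms(1) by (auto simp: columns_orthonormal_basis_def)
  have "set (cols B) \<subseteq> span (set (cols B))"
    using B by (intro in_own_span) (use cols_dim in blast)
  moreover have "col B j \<in> set (cols B)"
    using B assms(2) by (auto simp: cols_def)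
  ultimately show ?thesis
    using W by auto
qed

text \<open>The columns of the product are the images of the columns of \<open>B\<close>, and these
  lie in the kernel.\<close>

lemma mult_orthonormal_basis_of_kernel:
  assumes H: "H \<in> carrier_mat k n" and B: "columns_orthonormal_basis n d B (mat_kernel H)"
  shows "H * B = 0\<^sub>m k d"
proof (rule eq_matI)
  fix i j
  assume ij: "i < dim_row (0\<^sub>m k d :: real mat)" "j < dim_col (0\<^sub>m k d :: real mat)"
  have c: "B \<in> carrier_mat n d"
    using B by (auto simp: columns_orthonormal_basis_def)
  have "H *\<^sub>v col B j = 0\<^sub>v k"
    using columns_orthonormal_basis_col_in[OF B] ij mat_kernelD[OF H] by auto
  then have "vec_index (H *\<^sub>v col B j) i = 0"
    using ij by simp
  then show "(H * B) $$ (i, j) = 0\<^sub>m k d $$ (i, j)"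
    using ij H c by simp
qed (use H B in \<open>auto simp: columns_orthonormal_basis_def\<close>)

text \<open>Each entry of the product is the scalar product of a vector of the complement with a
  vector of \<open>W\<close>.\<close>

lemma orthonormal_basis_complement_transpose_mult:
  assumes A: "columns_orthonormal_basis n k A (vec_module.orthogonal_complement n W)"
    and B: "columns_orthonormal_basis n d B W"
  shows "A\<^sup>T * B = 0\<^sub>m k d"
proof (rule eq_matI)
  fix i j
  assume ij: "i < dim_row (0\<^sub>m k d :: real mat)" "j < dim_col (0\<^sub>m k d :: real mat)"
  have "col A i \<in> vec_module.orthogonal_complement n W" "col B j \<in> W"
    using ij columns_orthonormal_basis_col_in[OF A] columns_orthonormal_basis_col_in[OF B] by auto
  then have "col A i \<bullet> col B j = 0"
    by (auto simp: vec_module.orthogonal_complement_def)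
  then show "(A\<^sup>T * B) $$ (i, j) = 0\<^sub>m k d $$ (i, j)"
    using ij A B by (auto simp: columns_orthonormal_basis_def)
qed (use A B in \<open>auto simp: columns_orthonormal_basis_def\<close>)

section \<open>The derivative of the right transformation\<close>

lemma mat_deriv_constant_entry:
  assumes I: "is_interval I" "\<exists>x\<in>I. \<exists>y\<in>I. x < y" and t: "t \<in> I"
    and ij: "i < dim_row (A t)" "j < dim_col (A t)"
    and const: "\<And>s. s \<in> I \<Longrightarrow> A s $$ (i, j) = c"
  shows "mat_deriv I A t $$ (i, j) = 0"
proof -
  \<comment> \<open>\<open>vector_derivative\<close> chooses some derivative, so its value is
    determined only where derivatives within \<open>I\<close> are unique. This holds because a
    connected set with two distinct points has no isolated point.\<close>
  have "t islimpt I"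
    using I t by (intro connected_imp_perfect) (auto simp: is_interval_connected_1)
  then have "at t within I \<noteq> bot"
    by (simp add: trivial_limit_within)
  moreover have "((\<lambda>s. A s $$ (i, j)) has_vector_derivative 0) (at t within I)"
    by (rule has_vector_derivative_transform[OF t const has_vector_derivative_const])
  ultimately show ?thesis
    using ij by (simp add: mat_deriv_def vector_derivative_within)
qed

text \<open>The zero block is the only information about the derivative that is kept. The blocks
  \<open>P\<close>, \<open>R\<close>, \<open>W\<close> may stay anonymous: multiplication by
  \<open>L * H_E\<close> from the left kills \<open>W\<close>, and \<open>P\<close> and
  \<open>R\<close> reach only the first and the third block column, above the last block
  row.\<close>

lemma mat_deriv_K_orth:
  assumes I: "is_interval I" "\<exists>x\<in>I. \<exists>y\<in>I. x < y" and t: "t \<in> I"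
    and n: "n = d + k"
    and carrier: "\<And>s. s \<in> I \<Longrightarrow> Bd s \<in> carrier_mat n d" "\<And>s. s \<in> I \<Longrightarrow> Ba s \<in> carrier_mat n k"
  obtains P R W where "P \<in> carrier_mat n d" "R \<in> carrier_mat n k" "W \<in> carrier_mat k (d + (k + k))"
    "mat_deriv I (K_orth n k Bd Ba) t = (P @\<^sub>c 0\<^sub>m n k @\<^sub>c R) @\<^sub>r W"
proof -
  define D where "D = mat_deriv I (K_orth n k Bd Ba) t"
  have dim: "dim_row (K_orth n k Bd Ba s) = n + k" "dim_col (K_orth n k Bd Ba s) = d + (k + k)"
    if "s \<in> I" for s
    using carrier[OF that] n by (auto simp: K_orth_def)
  have D: "dim_row D = n + k" "dim_col D = d + (k + k)"
    using dim[OF t] by (auto simp: D_def mat_deriv_def)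
  \<comment> \<open>In the first \<open>n\<close> rows, the columns from \<open>d\<close> to
    \<open>d + k - 1\<close> of \<open>K_orth\<close> are zero on all of \<open>I\<close>.\<close>
  have zero: "D $$ (i, j) = 0" if "i < n" "d \<le> j" "j < d + k" for i j
    unfolding D_def
  proof (rule mat_deriv_constant_entry[OF I t])
    show "i < dim_row (K_orth n k Bd Ba t)" "j < dim_col (K_orth n k Bd Ba t)"
      using dim[OF t] that by auto
    show "K_orth n k Bd Ba s $$ (i, j) = 0" if "s \<in> I" for s
      using carrier[OF that] \<open>i < n\<close> \<open>d \<le> j\<close> \<open>j < d + k\<close> n by (auto simp: K_orth_def)
  qed
  show thesis
  proof (rule that)
    show "mat n d (\<lambda>(i, j). D $$ (i, j)) \<in> carrier_mat n d"
      "mat n k (\<lambda>(i, j). D $$ (i, d + k + j)) \<in> carrier_mat n k"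
      "mat k (d + (k + k)) (\<lambda>(i, j). D $$ (n + i, j)) \<in> carrier_mat k (d + (k + k))"
      by auto
    show "mat_deriv I (K_orth n k Bd Ba) t =
        (mat n d (\<lambda>(i, j). D $$ (i, j)) @\<^sub>c 0\<^sub>m n k @\<^sub>c mat n k (\<lambda>(i, j). D $$ (i, d + k + j))) @\<^sub>r
        mat k (d + (k + k)) (\<lambda>(i, j). D $$ (n + i, j))" (is "_ = ?R")
      unfolding D_def[symmetric]
    proof (rule eq_matI)
      fix i j
      assume "i < dim_row ?R" "j < dim_col ?R"
      then have ij: "i < n + k" "j < d + (k + k)"
        by auto
      consider "n \<le> i" | "i < n" "j < d" | "i < n" "d \<le> j" "j < d + k" | "i < n" "d + k \<le> j"
        by linarith
      then show "D $$ (i, j) = ?R $$ (i, j)"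
        using ij by cases (auto simp: zero)
    qed (use D in auto)
  qed
qed

section \<open>Block algebra of the transformed pair at a fixed point\<close>

locale orthonormal_splitting =
  fixes d k n :: nat and Bd Ba :: "real \<Rightarrow> real mat" and t :: real
  assumes n: "n = d + k"
    and Bd_carrier: "Bd t \<in> carrier_mat n d" and Ba_carrier: "Ba t \<in> carrier_mat n k"
    and BdBd: "(Bd t)\<^sup>T * Bd t = 1\<^sub>m d" and BaBa: "(Ba t)\<^sup>T * Ba t = 1\<^sub>m k"
    and BaBd: "(Ba t)\<^sup>T * Bd t = 0\<^sub>m k d"
begin

lemma BdBa: "(Bd t)\<^sup>T * Ba t = 0\<^sub>m d k"
proof -
  have "((Ba t)\<^sup>T * Bd t)\<^sup>T = (Bd t)\<^sup>T * Ba t"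
    using Bd_carrier Ba_carrier by (subst transpose_mult[of _ k n _ d]) auto
  then show ?thesis
    by (simp add: BaBd)
qed

lemma dims [simp]:
  "dim_row (Bd t) = n" "dim_col (Bd t) = d" "dim_row (Ba t) = n" "dim_col (Ba t) = k"
  using Bd_carrier Ba_carrier by auto

lemma Bd_Ba_resolution: "Bd t * (Bd t)\<^sup>T + Ba t * (Ba t)\<^sup>T = 1\<^sub>m n"
proof -
  have "((Bd t)\<^sup>T @\<^sub>r (Ba t)\<^sup>T) * (Bd t @\<^sub>c Ba t) = 1\<^sub>m n"
    by (simp add: append_mult BdBd BaBa BaBd BdBa one_mat_as_append n)
  \<comment> \<open>A left inverse of a square matrix is also a right inverse; squareness is
    \<open>n = d + k\<close>.\<close>
  then have "(Bd t @\<^sub>c Ba t) * ((Bd t)\<^sup>T @\<^sub>r (Ba t)\<^sup>T) = 1\<^sub>m n"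
    by (rule mat_mult_left_right_inverse[rotated 2]) (auto intro!: carrier_matI simp: n)
  then show ?thesis
    by (simp add: append_mult)
qed

text \<open>The basis vectors are rows of \<open>L\<close>, so the product computed from
  orthonormality is \<open>?L * ?L\<^sup>T\<close>; the other one follows since \<open>L\<close> is
  square.\<close>

lemma orthogonal_L_orth: "orthogonal_matrix_of_size (n + k) (L_orth n k Bd Ba t)"
proof -
  let ?L = "L_orth n k Bd Ba t"
  have L: "?L \<in> carrier_mat (n + k) (n + k)"
    by (auto intro!: carrier_matI simp: L_orth_def n)
  have "?L * ?L\<^sup>T = 1\<^sub>m (n + k)"
    by (simp add: L_orth_def append_mult BdBd BaBa BaBd BdBa n one_mat_as_append_3)
  with mat_mult_left_right_inverse[OF L _ this] L show ?thesis
    by (auto simp: orthogonal_matrix_of_size_def)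
qed

text \<open>Here the basis vectors sit in the columns, so \<open>?K\<^sup>T * ?K\<close> is computed
  first.\<close>

lemma orthogonal_K_orth: "orthogonal_matrix_of_size (n + k) (K_orth n k Bd Ba t)"
proof -
  let ?K = "K_orth n k Bd Ba t"
  have K: "?K \<in> carrier_mat (n + k) (n + k)"
    by (auto intro!: carrier_matI simp: K_orth_def n)
  have "?K\<^sup>T * ?K = 1\<^sub>m (n + k)"
    by (simp add: K_orth_def append_mult BdBd BaBa BaBd BdBa n one_mat_as_append_3)
  with mat_mult_left_right_inverse[OF _ K this] K show ?thesis
    by (auto simp: orthogonal_matrix_of_size_def)
qed

text \<open>The identity block of \<open>L\<close> meets the zero rows of \<open>H_E\<close>. The
  product is needed twice, in front of \<open>K\<close> and in front of the derivative of
  \<open>K\<close>.\<close>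

lemma L_orth_hessenberg_E:
  "L_orth n k Bd Ba t * hessenberg_E n k t =
    ((Bd t)\<^sup>T @\<^sub>c 0\<^sub>m d k) @\<^sub>r ((Ba t)\<^sup>T @\<^sub>c 0\<^sub>m k k) @\<^sub>r (0\<^sub>m k n @\<^sub>c 0\<^sub>m k k)"
  by (simp add: L_orth_def hessenberg_E_def four_block_mat_as_append append_mult n)

text \<open>Since \<open>K\<close> places \<open>Ba\<close> in its last block column, the identity
  \<open>(Ba t)\<^sup>T * Ba t\<close> lands right of the diagonal and forms the nilpotent
  block.\<close>

lemma transformed_E:
  "L_orth n k Bd Ba t * hessenberg_E n k t * K_orth n k Bd Ba t =
    four_block_mat (1\<^sub>m d) (0\<^sub>m d (k + k)) (0\<^sub>m (k + k) d)
      (four_block_mat (0\<^sub>m k k) (1\<^sub>m k) (0\<^sub>m k k) (0\<^sub>m k k))"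
proof -
  have "L_orth n k Bd Ba t * hessenberg_E n k t * K_orth n k Bd Ba t =
     (1\<^sub>m d @\<^sub>c 0\<^sub>m d k @\<^sub>c 0\<^sub>m d k) @\<^sub>r (0\<^sub>m k d @\<^sub>c 0\<^sub>m k k @\<^sub>c 1\<^sub>m k) @\<^sub>r
     (0\<^sub>m k d @\<^sub>c 0\<^sub>m k k @\<^sub>c 0\<^sub>m k k)"
    unfolding L_orth_hessenberg_E
    by (simp add: K_orth_def append_mult BdBd BaBa BaBd BdBa n)
  also have "\<dots> = four_block_mat (1\<^sub>m d) (0\<^sub>m d (k + k)) (0\<^sub>m (k + k) d)
      (four_block_mat (0\<^sub>m k k) (1\<^sub>m k) (0\<^sub>m k k) (0\<^sub>m k k))"
    by (rule eq_matI) auto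
  finally show ?thesis .
qed

text \<open>\<open>D\<close> stands for the derivative of \<open>K\<close>, known only through its
  block shape, so that what follows is pure matrix algebra.\<close>

context
  fixes H11 H12 H21 :: "real \<Rightarrow> real mat" and D P R W :: "real mat"
  assumes H: "H11 t \<in> carrier_mat n n" "H12 t \<in> carrier_mat n k" "H21 t \<in> carrier_mat k n"
    and H21_Bd: "H21 t * Bd t = 0\<^sub>m k d"
    and D: "P \<in> carrier_mat n d" "R \<in> carrier_mat n k" "W \<in> carrier_mat k (d + (k + k))"
      "D = (P @\<^sub>c 0\<^sub>m n k @\<^sub>c R) @\<^sub>r W"
begin

lemma dims_H:
  "dim_row (H11 t) = n" "dim_col (H11 t) = n" "dim_row (H12 t) = n" "dim_col (H12 t) = k"
  "dim_row (H21 t) = k" "dim_col (H21 t) = n" "dim_row P = n" "dim_col P = d"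
  "dim_row R = n" "dim_col R = k" "dim_row W = k" "dim_col W = d + (k + k)"
  using H D by auto

text \<open>In the last block row, the first zero comes from \<open>H21_Bd\<close>, the second from
  the zero block of \<open>hessenberg_F\<close>, and \<open>D\<close> contributes nothing. The
  middle block column is free of derivative terms because that of \<open>D\<close> vanishes in its
  first \<open>n\<close> rows.\<close>

lemma transformed_F:
  "L_orth n k Bd Ba t * hessenberg_F k H11 H12 H21 t * K_orth n k Bd Ba t +
      L_orth n k Bd Ba t * hessenberg_E n k t * D =
    (((Bd t)\<^sup>T * H11 t * Bd t + (Bd t)\<^sup>T * P) @\<^sub>c ((Bd t)\<^sup>T * H12 t) @\<^sub>c
      ((Bd t)\<^sup>T * H11 t * Ba t + (Bd t)\<^sup>T * R)) @\<^sub>r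
    (((Ba t)\<^sup>T * H11 t * Bd t + (Ba t)\<^sup>T * P) @\<^sub>c ((Ba t)\<^sup>T * H12 t) @\<^sub>c
      ((Ba t)\<^sup>T * H11 t * Ba t + (Ba t)\<^sup>T * R)) @\<^sub>r
    (0\<^sub>m k d @\<^sub>c 0\<^sub>m k k @\<^sub>c (H21 t * Ba t))"
  unfolding L_orth_hessenberg_E D
  by (simp add: L_orth_def K_orth_def hessenberg_F_def four_block_mat_as_append append_mult n dims_H H21_Bd)

end

end

section \<open>Orthogonal transformation of a Hessenberg pair of order 2 to PreSCF\<close>

theorem mainTheorem4:
  fixes I :: "real set"
    and m1 m2 \<theta> d a m :: nat
    and H11 H12 H21 Bd Ba H_E H_F L K E0 F0 :: "real \<Rightarrow> real mat"
    and N :: "real mat"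
  assumes interval: "is_interval I" "\<exists>x\<in>I. \<exists>y\<in>I. x < y"
    and sizes: "m1 \<ge> m2" "m2 > 0"
    and params: "\<theta> = m2" "m = m1 + m2" "d = m1 - m2" "a = 2 * \<theta>"
    and smooth_H: "C1_mat_on I m1 m1 H11" "C1_mat_on I m1 m2 H12" "C1_mat_on I m2 m1 H21"
    and nonsing: "\<forall>t\<in>I. invertible_mat (H21 t * H12 t)"
    and smooth_B: "C1_mat_on I m1 (m1 - \<theta>) Bd" "C1_mat_on I m1 \<theta> Ba"
    and Bd: "\<forall>t\<in>I. columns_orthonormal_basis m1 (m1 - \<theta>) (Bd t) (mat_kernel (H21 t))"
    and Ba: "\<forall>t\<in>I. columns_orthonormal_basis m1 \<theta> (Ba t)
                     (vec_module.orthogonal_complement m1 (mat_kernel (H21 t)))"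
    and H_E: "H_E = hessenberg_E m1 m2"
    and H_F: "H_F = hessenberg_F m2 H11 H12 H21"
    and L: "L = L_orth m1 \<theta> Bd Ba"
    and K: "K = K_orth m1 \<theta> Bd Ba"
    and N: "N = four_block_mat (0\<^sub>m \<theta> \<theta>) (1\<^sub>m \<theta>) (0\<^sub>m \<theta> \<theta>) (0\<^sub>m \<theta> \<theta>)"
    and E0: "E0 = (\<lambda>t. L t * H_E t * K t)"
    and F0: "F0 = (\<lambda>t. L t * H_F t * K t + L t * H_E t * mat_deriv I K t)"
  shows "(\<forall>t\<in>I. orthogonal_matrix_of_size m (L t) \<and> orthogonal_matrix_of_size m (K t)) \<and>
    (\<forall>t\<in>I. L t * H_E t * K t = four_block_mat (1\<^sub>m d) (0\<^sub>m d a) (0\<^sub>m a d) N) \<and>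
    preSCF I d [\<theta>, \<theta>] (\<lambda>t. N) E0 F0 \<and>
    (\<forall>t\<in>I. \<exists>F11 F12 F21 F22 G. split_block (F0 t) d d = (F11, F12, F21, F22) \<and>
       F22 \<in> carrier_mat a a \<and>
       split_block F22 \<theta> \<theta> = ((Ba t)\<^sup>T * H12 t, G, 0\<^sub>m \<theta> \<theta>, H21 t * Ba t) \<and>
       invertible_mat ((Ba t)\<^sup>T * H12 t) \<and> invertible_mat (H21 t * Ba t))"
proof -
  \<comment> \<open>With a single block size \<open>k\<close> and \<open>m1 = d + k\<close>, the
    truncated subtractions of natural numbers disappear.\<close>
  define k where "k = m2"
  have n: "m1 = d + k" and eqs: "\<theta> = k" "m = m1 + k" "a = k + k" "m1 - \<theta> = d" "m2 = k"
    using sizes params by (auto simp: k_def)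
  \<comment> \<open>All claims are gathered at one point, because the same blocks of
    \<open>F0 t\<close> witness both \<open>preSCF\<close> and the final existential
    statement.\<close>
  have pointwise: "orthogonal_matrix_of_size m (L t) \<and> orthogonal_matrix_of_size m (K t) \<and>
      E0 t = four_block_mat (1\<^sub>m d) (0\<^sub>m d a) (0\<^sub>m a d) N \<and> F0 t \<in> carrier_mat (d + a) (d + a) \<and>
      (\<exists>F11 F12 F21 F22 G. split_block (F0 t) d d = (F11, F12, F21, F22) \<and>
         F22 \<in> carrier_mat a a \<and>
         split_block F22 \<theta> \<theta> = ((Ba t)\<^sup>T * H12 t, G, 0\<^sub>m \<theta> \<theta>, H21 t * Ba t) \<and>
         invertible_mat ((Ba t)\<^sup>T * H12 t) \<and> invertible_mat (H21 t * Ba t) \<and>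
         invertible_mat F22 \<and> block_upper_triangular [\<theta>, \<theta>] F22 \<and>
         block_upper_triangular [\<theta>, \<theta>] (F21 * F12))"
    if t: "t \<in> I" for t
  proof -
    have H: "H11 t \<in> carrier_mat m1 m1" "H12 t \<in> carrier_mat m1 k" "H21 t \<in> carrier_mat k m1"
      using smooth_H t eqs by (auto simp: C1_mat_on_def)
    \<comment> \<open>Stated for every \<open>s\<close> in \<open>I\<close>, since the derivative at
      \<open>t\<close> depends on values at other points.\<close>
    have B: "Bd s \<in> carrier_mat m1 d" "Ba s \<in> carrier_mat m1 k" if "s \<in> I" for s
      using smooth_B that eqs by (auto simp: C1_mat_on_def)
    have basis: "columns_orthonormal_basis m1 d (Bd t) (mat_kernel (H21 t))"
      "columns_orthonormal_basis m1 k (Ba t) (vec_module.orthogonal_complement m1 (mat_kernel (H21 t)))"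
      using Bd Ba t eqs by auto
    interpret orthonormal_splitting d k m1 Bd Ba t
      using n B[OF t] columns_orthonormal_basis_transpose_mult[OF basis(1)]
        columns_orthonormal_basis_transpose_mult[OF basis(2)]
        orthonormal_basis_complement_transpose_mult[OF basis(2,1)]
      by unfold_locales
    have H21_Bd: "H21 t * Bd t = 0\<^sub>m k d"
      by (rule mult_orthonormal_basis_of_kernel[OF H(3) basis(1)])

    have "H21 t * H12 t = H21 t * (Bd t * (Bd t)\<^sup>T + Ba t * (Ba t)\<^sup>T) * H12 t"
      using H by (simp add: Bd_Ba_resolution)
    also have "\<dots> = (H21 t * Bd t * (Bd t)\<^sup>T + H21 t * Ba t * (Ba t)\<^sup>T) * H12 t"
      using H B[OF t] by (simp add: mult_add_distrib_mat[of _ k m1 _ m1] assoc_mult_mat[of _ k m1])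
    also have "\<dots> = (H21 t * Ba t * (Ba t)\<^sup>T) * H12 t"
      unfolding H21_Bd using H by (simp add: add_zero_mat_dim)
    also have "\<dots> = (H21 t * Ba t) * ((Ba t)\<^sup>T * H12 t)"
      by (rule assoc_mult_mat[of _ k k _ m1]) (use H B[OF t] in auto)
    finally have prod: "invertible_mat ((H21 t * Ba t) * ((Ba t)\<^sup>T * H12 t))"
      using nonsing t by metis
    have "H21 t * Ba t \<in> carrier_mat k k" "(Ba t)\<^sup>T * H12 t \<in> carrier_mat k k"
      using H B[OF t] by auto
    note inv = invertible_mat_factors[OF this prod]

    obtain P R W where D: "P \<in> carrier_mat m1 d" "R \<in> carrier_mat m1 k" "W \<in> carrier_mat k (d + (k + k))"
        "mat_deriv I K t = (P @\<^sub>c 0\<^sub>m m1 k @\<^sub>c R) @\<^sub>r W"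
      unfolding K eqs by (rule mat_deriv_K_orth[where Bd = Bd and Ba = Ba, OF interval t n B])
    \<comment> \<open>Names for the blocks of \<open>F0 t\<close>, whose block rows are
      \<open>Z, V, Y\<close>, then \<open>X, M, G\<close>, then \<open>0, 0, Q\<close>.\<close>
    define X where "X = (Ba t)\<^sup>T * H11 t * Bd t + (Ba t)\<^sup>T * P"
    define Y where "Y = (Bd t)\<^sup>T * H11 t * Ba t + (Bd t)\<^sup>T * R"
    define Z where "Z = (Bd t)\<^sup>T * H11 t * Bd t + (Bd t)\<^sup>T * P"
    define G where "G = (Ba t)\<^sup>T * H11 t * Ba t + (Ba t)\<^sup>T * R"
    define M where "M = (Ba t)\<^sup>T * H12 t"
    define V where "V = (Bd t)\<^sup>T * H12 t"
    define Q where "Q = H21 t * Ba t"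
    have carrier: "X \<in> carrier_mat k d" "Y \<in> carrier_mat d k" "Z \<in> carrier_mat d d"
      "G \<in> carrier_mat k k" "M \<in> carrier_mat k k" "V \<in> carrier_mat d k" "Q \<in> carrier_mat k k"
      using H B[OF t] D by (auto simp: X_def Y_def Z_def G_def M_def V_def Q_def)
    note dim = carrier[THEN carrier_matD(1)] carrier[THEN carrier_matD(2)]
    define F12 F21 F22 where "F12 = V @\<^sub>c Y" and "F21 = X @\<^sub>r 0\<^sub>m k d"
      and "F22 = (M @\<^sub>c G) @\<^sub>r (0\<^sub>m k k @\<^sub>c Q)"
    have "F0 t = (Z @\<^sub>c V @\<^sub>c Y) @\<^sub>r (X @\<^sub>c M @\<^sub>c G) @\<^sub>r (0\<^sub>m k d @\<^sub>c 0\<^sub>m k k @\<^sub>c Q)"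
      using transformed_F[of H11 H12 H21, OF H H21_Bd D]
      by (simp add: F0 L K H_E H_F eqs X_def Y_def Z_def G_def M_def V_def Q_def)
    \<comment> \<open>The 3 by 3 grid becomes a 2 by 2 one by merging the last two block rows and
      the last two block columns.\<close>
    also have "\<dots> = (Z @\<^sub>c F12) @\<^sub>r (F21 @\<^sub>c F22)"
      unfolding F12_def F21_def F22_def by (subst append_cols_interchange[of X]) (auto simp: dim)
    finally have F: "F0 t = (Z @\<^sub>c F12) @\<^sub>r (F21 @\<^sub>c F22)" .
    have "split_block (F0 t) d d = (Z, F12, F21, F22)"
      using split_block_append[of Z F12 F21 F22] by (simp add: F F12_def F21_def F22_def dim)
    moreover have "F0 t \<in> carrier_mat (d + a) (d + a)" "F22 \<in> carrier_mat a a"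
      by (auto intro!: carrier_matI simp: F F21_def F12_def F22_def dim eqs)
    moreover have "split_block F22 \<theta> \<theta> = (M, G, 0\<^sub>m \<theta> \<theta>, Q)"
      using split_block_append[of M G "0\<^sub>m k k" Q] by (simp add: F22_def dim eqs)
    moreover have "invertible_mat F22"
      using inv carrier unfolding F22_def by (intro invertible_mat_upper_block) (auto simp: M_def Q_def)
    moreover have "block_upper_triangular [\<theta>, \<theta>] F22"
      using carrier unfolding F22_def eqs by (intro block_upper_triangular_append)
    \<comment> \<open>The zero last block row of \<open>F21\<close> is inherited by the product, so
      its whole lower half vanishes.\<close>
    moreover have "F21 * F12 = ((X * V) @\<^sub>c (X * Y)) @\<^sub>r (0\<^sub>m k k @\<^sub>c 0\<^sub>m k k)"
      unfolding F21_def F12_def by (simp add: append_mult dim)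
    then have "block_upper_triangular [\<theta>, \<theta>] (F21 * F12)"
      using carrier unfolding eqs by (auto intro!: block_upper_triangular_append)
    moreover have "orthogonal_matrix_of_size m (L t)" "orthogonal_matrix_of_size m (K t)"
      using orthogonal_L_orth orthogonal_K_orth by (simp_all add: L K eqs)
    moreover have "E0 t = four_block_mat (1\<^sub>m d) (0\<^sub>m d a) (0\<^sub>m a d) N"
      using transformed_E by (simp add: E0 L K H_E N eqs)
    ultimately show ?thesis
      using inv unfolding M_def Q_def by blast
  qed
  have N_carrier: "N \<in> carrier_mat a a"
    by (intro carrier_matI) (simp_all add: N eqs)
  have sum: "sum_list [\<theta>, \<theta>] = a"
    by (simp add: eqs)
  have "preSCF I d [\<theta>, \<theta>] (\<lambda>t. N) E0 F0"
    unfolding preSCF_def Let_def sum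
  proof (intro ballI conjI)
    fix t
    assume t: "t \<in> I"
    show "case split_block (F0 t) d d of (F11, F12, F21, F22) \<Rightarrow>
        block_upper_triangular [\<theta>, \<theta>] F22 \<and> block_upper_triangular [\<theta>, \<theta>] (F21 * F12) \<and>
        invertible_mat F22"
      using pointwise[OF t] by (elim conjE exE) simp
  qed (use pointwise N_carrier in auto)
  moreover have "\<forall>t\<in>I. L t * H_E t * K t = four_block_mat (1\<^sub>m d) (0\<^sub>m d a) (0\<^sub>m a d) N"
    using pointwise by (simp add: E0)
  moreover have "\<forall>t\<in>I. \<exists>F11 F12 F21 F22 G. split_block (F0 t) d d = (F11, F12, F21, F22) \<and>
       F22 \<in> carrier_mat a a \<and>
       split_block F22 \<theta> \<theta> = ((Ba t)\<^sup>T * H12 t, G, 0\<^sub>m \<theta> \<theta>, H21 t * Ba t) \<and>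
       invertible_mat ((Ba t)\<^sup>T * H12 t) \<and> invertible_mat (H21 t * Ba t)"
    using pointwise by meson
  ultimately show ?thesis
    using pointwise by blast
qed

end
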